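(* Let $\psi:\mathbb{R}^m\to\mathbb{R}\cup\{+\infty\}$ be proper, lower semicontinuous and convex with $\operatorname{argmin}\psi\neq\emptyset$, let $p\ge 1$, $\lambda>0$, $y^0\in\mathbb{R}^m$, and let $y^\star\in\operatorname{argmin}\psi$. Let $c\ge 0$ and $\varepsilon_k=\frac{c}{(k+1)^{p+1}}$ for $k\in\mathbb{N}_0$. Let $\{y^k\}$ be a sequence generated by the inexact power proximal point method with averaging (described in the context) with starting point $y^0$, errors $\{\varepsilon_k\}$ and parameters $\{\theta_k\}$. Then the following hold. (i) If $\theta_k=\frac{A_k}{A_{k+1}}$ for all $k\in\mathbb{N}_0$, where $A_k=k^{p+1}$, then for all $k\ge 1$ $$\psi(y^k)-\psi(y^\star)\le\frac{\lambda^{-p}(p+1)^p\|y^0-y^\star\|^{p+1}+c}{k^p}.$$ (ii) If $\theta_k=1$ for all $k\in\mathbb{N}_0$, then for all $k\ge 1$ $$\psi(y^k)-\psi(y^\star)\le\frac{\lambda^{-p}(p+1)^pD_\beta^{p+1}+c}{k^p},$$ where $\beta:=\sum_{k=0}^\infty\varepsilon_k$ and $D_\beta:=\sup\{\|y^\star-y\| : \psi(y)\le\psi(y^0)+\beta\}$, which is assumed to be finite.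
   Context: $\|\cdot\|$ denotes $\|\cdot\|_r$ on $\mathbb{R}^m$, where either $r=2$ or $r=p+1$. Put $\phi:=\frac{1}{p+1}\|\cdot\|^{p+1}$, and let $q$ be given by $\frac1{p+1}+\frac1{q+1}=1$ (so $q=1/p$). The convex conjugate is $\phi^*=\frac1{q+1}\|\cdot\|_*^{q+1}$, where $\|\cdot\|_*$ is the dual norm of $\|\cdot\|$; both $\phi$ and $\phi^*$ are differentiable. For $\varepsilon\ge0$ and $\bar y\in\operatorname{dom}\psi$, the $\varepsilon$-subdifferential $\partial_\varepsilon\psi(\bar y)$ is the set of all $v$ such that $\psi(y)\ge\psi(\bar y)+\langle v,y-\bar y\rangle-\varepsilon$ for all $y\in\operatorname{dom}\psi$. Inexact power proximal point method with averaging: given $y^0\in\mathbb{R}^m$ and parameters $\theta_k\in[0,1]$, for $k=0,1,2,\dots$ set $w^k=\theta_ky^k+(1-\theta_k)y^0$ and find a pair $(v^k,y^{k+1})$ with $$v^k\in\partial_{\varepsilon_k}\psi(y^{k+1}),\qquad y^{k+1}=w^k-\lambda\nabla\phi^*(v^k).$$ *)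

theory Defs
  imports "HOL-Analysis.Analysis"
begin

section \<open>Extended-real-valued convex functions\<close>

definition domain :: "('a \<Rightarrow> ereal) \<Rightarrow> 'a set" where
  "domain f = {x. f x < \<infinity>}"

definition proper :: "('a \<Rightarrow> ereal) \<Rightarrow> bool" where
  "proper f \<longleftrightarrow> (\<forall>x. f x \<noteq> -\<infinity>) \<and> domain f \<noteq> {}"

definition lsc :: "('a::topological_space \<Rightarrow> ereal) \<Rightarrow> bool" where
  "lsc f \<longleftrightarrow> (\<forall>x. f x \<le> Liminf (at x) f)"

text \<open>Meant for functions that never take the value \<open>-\<infinity>\<close>, so that the right-hand side
  never has the form \<open>\<infinity> + (-\<infinity>)\<close>; at \<open>u = 0\<close> the convention \<open>0 * \<infinity> = 0\<close> of \<^typ>\<open>ereal\<close>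
  makes the condition trivial.\<close>

definition ereal_convex :: "('a::real_vector \<Rightarrow> ereal) \<Rightarrow> bool" where
  "ereal_convex f \<longleftrightarrow> (\<forall>x y. \<forall>u\<ge>0. \<forall>v\<ge>0. u + v = 1 \<longrightarrow>
     f (u *\<^sub>R x + v *\<^sub>R y) \<le> ereal u * f x + ereal v * f y)"

definition argmin_set :: "('a \<Rightarrow> ereal) \<Rightarrow> 'a set" where
  "argmin_set f = {x. is_arg_min f (\<lambda>_. True) x}"

definition eps_subdifferential ::
    "('a::real_inner \<Rightarrow> ereal) \<Rightarrow> real \<Rightarrow> 'a \<Rightarrow> 'a set" where
  "eps_subdifferential f e x =
     {v. x \<in> domain f \<and> (\<forall>y\<in>domain f. f y \<ge> f x + ereal (inner v (y - x)) - ereal e)}"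

definition convex_conjugate :: "('a::real_inner \<Rightarrow> ereal) \<Rightarrow> 'a \<Rightarrow> ereal" where
  "convex_conjugate f v = (SUP x. ereal (inner v x) - f x)"

definition grad :: "('a::real_inner \<Rightarrow> real) \<Rightarrow> 'a \<Rightarrow> 'a" where
  "grad f x = (THE D. GDERIV f x :> D)"

section \<open>The power proximal term\<close>

definition lr_norm :: "real \<Rightarrow> real ^ 'n \<Rightarrow> real" where
  "lr_norm r x = (\<Sum>i\<in>UNIV. \<bar>x $ i\<bar> powr r) powr (1 / r)"

definition phi :: "real \<Rightarrow> real \<Rightarrow> real ^ 'n \<Rightarrow> real" where
  "phi r p x = 1 / (p + 1) * lr_norm r x powr (p + 1)"

text \<open>For \<open>p \<ge> 1\<close> and \<open>r \<ge> 1\<close> the conjugate of \<^const>\<open>phi\<close> is finite everywhere: it is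
  \<open>1 / (q + 1)\<close> times the \<open>(q + 1)\<close>-st power of the dual norm, where \<open>q = 1 / p\<close>. So
  \<^const>\<open>real_of_ereal\<close> only changes the type here.\<close>

definition phi_conj :: "real \<Rightarrow> real \<Rightarrow> real ^ 'n \<Rightarrow> real" where
  "phi_conj r p v = real_of_ereal (convex_conjugate (\<lambda>x. ereal (phi r p x)) v)"

section \<open>Inexact power proximal point method with averaging\<close>

definition inexact_power_ppm_avg ::
    "real \<Rightarrow> real \<Rightarrow> real \<Rightarrow> (real ^ 'n \<Rightarrow> ereal) \<Rightarrow> (nat \<Rightarrow> real) \<Rightarrow> (nat \<Rightarrow> real)
     \<Rightarrow> real ^ 'n \<Rightarrow> (nat \<Rightarrow> real ^ 'n) \<Rightarrow> bool" where
  "inexact_power_ppm_avg r p \<tau> \<psi> \<epsilon> \<theta> y0 y \<longleftrightarrow>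
     y 0 = y0 \<and> (\<forall>k. 0 \<le> \<theta> k \<and> \<theta> k \<le> 1) \<and>
     (\<exists>w v. \<forall>k.
        w k = \<theta> k *\<^sub>R y k + (1 - \<theta> k) *\<^sub>R y0 \<and>
        v k \<in> eps_subdifferential \<psi> (\<epsilon> k) (y (Suc k)) \<and>
        y (Suc k) = w k - \<tau> *\<^sub>R grad (phi_conj r p) (v k))"

text \<open>The supremum is taken in \<^typ>\<open>ereal\<close> so that its finiteness is a genuine condition.\<close>

definition D_beta ::
    "real \<Rightarrow> (real ^ 'n \<Rightarrow> ereal) \<Rightarrow> real ^ 'n \<Rightarrow> real ^ 'n \<Rightarrow> real \<Rightarrow> ereal" where
  "D_beta r \<psi> ystar y0 \<beta> =
     (SUP y\<in>{y. \<psi> y \<le> \<psi> y0 + ereal \<beta>}. ereal (lr_norm r (ystar - y)))"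

end

theory Submission
  imports Defs
begin

text \<open>
  The idea is to forget the gradient step and keep one inequality: each iterate is an
  \<open>\<epsilon>\<^sub>k\<close>-minimiser of a proximal problem,
  \<open>\<psi> (y\<^sub>k\<^sub>+\<^sub>1) \<le> \<psi> x + \<tau>\<^sup>-\<^sup>p / (p + 1) * \<parallel>w\<^sub>k - x\<parallel>\<^sup>p\<^sup>+\<^sup>1 + \<epsilon>\<^sub>k\<close> for every \<open>x\<close>.
  Indeed \<open>(w\<^sub>k - y\<^sub>k\<^sub>+\<^sub>1) / \<tau>\<close> is the gradient of the conjugate of \<open>\<phi>\<close> at \<open>v\<^sub>k\<close>, so it maximises
  \<open>\<langle>v\<^sub>k, \<cdot>\<rangle> - \<phi>\<close>; adding this optimality to the \<open>\<epsilon>\<^sub>k\<close>-subgradient inequality cancels \<open>v\<^sub>k\<close>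
  (\<open>prox_step_bound\<close>). The maximiser is explicit: Young's inequality exhibits it, in both norms,
  through the map \<open>x \<mapsto> \<parallel>x\<parallel>\<^sup>1\<^sup>/\<^sup>p sgn x\<close>, and its continuity alone makes the conjugate
  differentiable with this gradient (\<open>grad_phi_conj_maximises\<close>).

  The inequality is then tested at \<open>x = t\<^sub>k y\<^sub>k + (1 - t\<^sub>k) y\<^sup>*\<close> with
  \<open>t\<^sub>k = (k / (k + 1))\<^sup>p\<^sup>+\<^sup>1\<close>. With averaging, \<open>w\<^sub>k - x = (1 - t\<^sub>k) (y\<^sub>0 - y\<^sup>*)\<close>; without it,
  \<open>w\<^sub>k - x = (1 - t\<^sub>k) (y\<^sub>k - y\<^sup>*)\<close>, and \<open>y\<^sub>k\<close> stays in the level set that defines \<open>D\<^sub>\<beta>\<close>, because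
  testing at \<open>x = y\<^sub>k\<close> shows that a step raises \<open>\<psi>\<close> by at most \<open>\<epsilon>\<^sub>k\<close>. Hence both parts are the
  same statement \<open>prox_sequence_rate\<close>, for a radius \<open>R\<close> with \<open>\<parallel>w\<^sub>k - x\<parallel> \<le> (1 - t\<^sub>k) R\<close>. By
  convexity the gaps \<open>\<delta>\<^sub>k = \<psi> (y\<^sub>k) - \<psi> (y\<^sup>*)\<close> satisfy a linear recurrence. The weights \<open>k\<^sup>p\<^sup>+\<^sup>1\<close>
  telescope it, and since \<open>1 - t\<^sub>k \<le> (p + 1) / (k + 1)\<close> every step adds at most the same
  constant to \<open>k\<^sup>p\<^sup>+\<^sup>1 \<delta>\<^sub>k\<close> (\<open>averaged_recurrence_rate\<close>); dividing by \<open>k\<^sup>p\<^sup>+\<^sup>1\<close> gives the rate.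
\<close>

section \<open>The gradient of a conjugate as a maximiser\<close>

lemma GDERIV_unique:
  assumes "GDERIV f x :> D" and "GDERIV f x :> E"
  shows "D = E"
proof -
  have "(\<lambda>h. inner h D) = (\<lambda>h. inner h E)"
    using assms has_derivative_unique unfolding gderiv_def by blast
  then have "inner (D - E) D = inner (D - E) E"
    by metis
  then have "inner (D - E) (D - E) = 0"
    by (simp add: inner_diff_right)
  then show ?thesis
    by simp
qed

text \<open>The subgradient inequalities at \<open>v\<close> and at \<open>u\<close> squeeze the linearisation error between
  \<open>0\<close> and \<open>\<langle>g u - g v, u - v\<rangle>\<close>, which is \<open>o(\<parallel>u - v\<parallel>)\<close> when \<open>g\<close> is continuous.\<close>

lemma GDERIV_of_continuous_subgradient:
  fixes F :: "'a::real_inner \<Rightarrow> real" and g :: "'a \<Rightarrow> 'a"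
  assumes sub: "\<And>u v. F u \<ge> F v + inner (g v) (u - v)"
    and cont: "isCont g v"
  shows "GDERIV F v :> g v"
proof -
  have "((\<lambda>u. norm (F u - F v - inner (u - v) (g v)) / norm (u - v)) \<longlongrightarrow> 0) (at v)"
  proof (rule Lim_null_comparison)
    show "\<forall>\<^sub>F u in at v. norm (norm (F u - F v - inner (u - v) (g v)) / norm (u - v)) \<le> norm (g u - g v)"
    proof (rule always_eventually, rule allI)
      fix u
      have lower: "0 \<le> F u - F v - inner (u - v) (g v)"
        using sub[of v u] by (simp add: inner_commute)
      have "F u - F v - inner (u - v) (g v) \<le> inner (g u - g v) (u - v)"
        using sub[of u v] by (simp add: inner_commute inner_diff_left inner_diff_right)
      also have "\<dots> \<le> norm (g u - g v) * norm (u - v)"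
        by (rule norm_cauchy_schwarz)
      finally have "norm (F u - F v - inner (u - v) (g v)) \<le> norm (g u - g v) * norm (u - v)"
        using lower by simp
      then show "norm (norm (F u - F v - inner (u - v) (g v)) / norm (u - v)) \<le> norm (g u - g v)"
        by (cases "u = v") (simp_all add: divide_le_eq)
    qed
    show "((\<lambda>u. norm (g u - g v)) \<longlongrightarrow> 0) (at v)"
      using cont by (simp add: isCont_def LIM_zero tendsto_norm_zero)
  qed
  then have "(F has_derivative (\<lambda>h. inner h (g v))) (at v)"
    by (simp add: has_derivative_iff_norm bounded_linear_inner_left)
  then show ?thesis
    by (simp add: gderiv_def)
qed

text \<open>The envelope theorem for the conjugate: a maximiser of \<open>\<langle>v, \<cdot>\<rangle> - f\<close> is a subgradient of the
  conjugate at \<open>v\<close>, so a continuous choice of maximisers is its gradient.\<close>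

lemma grad_conjugate_eq_maximiser:
  fixes f :: "'a::real_inner \<Rightarrow> real" and g :: "'a \<Rightarrow> 'a"
  assumes max: "\<And>v x. inner v x - f x \<le> inner v (g v) - f (g v)"
    and cont: "\<And>v. isCont g v"
  shows "grad (\<lambda>v. real_of_ereal (convex_conjugate (\<lambda>x. ereal (f x)) v)) v = g v"
proof -
  define F where "F v = inner v (g v) - f (g v)" for v
  have conj: "convex_conjugate (\<lambda>x. ereal (f x)) v = ereal (F v)" for v
    unfolding convex_conjugate_def
  proof (rule antisym)
    show "(SUP x. ereal (inner v x) - ereal (f x)) \<le> ereal (F v)"
      by (rule SUP_least) (simp add: F_def max)
    show "ereal (F v) \<le> (SUP x. ereal (inner v x) - ereal (f x))"
      by (rule SUP_upper2[of "g v"]) (simp_all add: F_def)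
  qed
  have "F u \<ge> F v + inner (g v) (u - v)" for u v
    using max[of u "g v"] by (simp add: F_def inner_diff_right inner_commute)
  then have "GDERIV F v :> g v"
    by (rule GDERIV_of_continuous_subgradient) (rule cont)
  then have "grad F v = g v"
    unfolding grad_def by (blast intro: GDERIV_unique)
  then show ?thesis
    by (simp add: conj)
qed

section \<open>Duality for the power function\<close>

text \<open>The gradient of \<open>x \<mapsto> \<parallel>x\<parallel>\<^sup>q\<^sup>+\<^sup>1 / (q + 1)\<close> on an inner product space. It is used both
  on the whole space (Euclidean norm) and on each real coordinate (\<open>\<ell>\<^sub>r\<close> norm with
  \<open>r = p + 1\<close>).\<close>

definition power_map :: "real \<Rightarrow> 'a::real_normed_vector \<Rightarrow> 'a" where
  "power_map q x = norm x powr q *\<^sub>R sgn x"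

lemma norm_power_map: "norm (power_map q x) = norm x powr q"
  by (simp add: power_map_def norm_sgn)

lemma isCont_power_map:
  fixes x :: "'a::real_normed_vector"
  assumes "q > 0"
  shows "isCont (power_map q) x"
proof (cases "x = 0")
  case True
  have "((\<lambda>u. norm u powr q) \<longlongrightarrow> 0) (at (0::'a))"
    using assms by (intro tendsto_zero_powrI[where b = q] tendsto_norm_zero tendsto_ident_at) auto
  then have "(power_map q \<longlongrightarrow> 0) (at (0::'a))"
    using tendsto_norm_zero_cancel[of "power_map q"] by (simp add: norm_power_map)
  then show ?thesis
    using True by (simp add: isCont_def power_map_def)
next
  case False
  then show ?thesis
    unfolding power_map_def by (intro continuous_intros) auto
qed

text \<open>Cauchy-Schwarz and Young's inequality bound the left-hand side by
  \<open>\<parallel>v\<parallel>\<^sup>q / q\<close>, where \<open>q\<close> is the exponent conjugate to \<open>p + 1\<close>; both are equalities at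
  \<open>x = \<parallel>v\<parallel>\<^sup>1\<^sup>/\<^sup>p sgn v\<close>.\<close>

lemma power_map_maximises:
  fixes v x :: "'a::real_inner"
  assumes "p > 0"
  shows "inner v x - norm x powr (p + 1) / (p + 1)
    \<le> inner v (power_map (1 / p) v) - norm (power_map (1 / p) v) powr (p + 1) / (p + 1)"
proof -
  define q where "q = 1 / p + 1"
  have q: "q > 1" "1 / (p + 1) + 1 / q = 1"
    using assms by (auto simp: q_def field_simps)
  have "inner v x \<le> norm x * norm v"
    by (metis mult.commute norm_cauchy_schwarz)
  also have "\<dots> \<le> norm x powr (p + 1) / (p + 1) + norm v powr q / q"
    using assms q by (intro Youngs_inequality) auto
  finally have "inner v x - norm x powr (p + 1) / (p + 1) \<le> norm v powr q / q"
    by simp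
  moreover have "inner v (power_map (1 / p) v) = norm v powr q"
    by (cases "v = 0")
       (simp_all add: power_map_def sgn_div_norm dot_square_norm q_def powr_add power2_eq_square)
  moreover have "norm (power_map (1 / p) v) powr (p + 1) = norm v powr q"
    using assms by (simp add: norm_power_map powr_powr q_def field_simps)
  moreover have "norm v powr q - norm v powr q / (p + 1) = norm v powr q / q"
  proof -
    have "1 - 1 / (p + 1) = 1 / q"
      using q by simp
    then show ?thesis
      by (metis mult.right_neutral right_diff_distrib times_divide_eq_right)
  qed
  ultimately show ?thesis
    by simp
qed

lemma lr_norm_2: "lr_norm 2 x = norm x"
  by (simp add: lr_norm_def norm_vec_def L2_set_def powr_half_sqrt sum_nonneg)

lemma lr_norm_nonneg: "lr_norm r x \<ge> 0"
  by (simp add: lr_norm_def)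

lemma lr_norm_minus_commute: "lr_norm r (x - y) = lr_norm r (y - x)"
  by (simp add: lr_norm_def abs_minus_commute)

lemma lr_norm_scaleR:
  assumes "r > 0" and "t \<ge> 0"
  shows "lr_norm r (t *\<^sub>R x) = t * lr_norm r x"
proof -
  have "(\<Sum>i\<in>UNIV. \<bar>(t *\<^sub>R x) $ i\<bar> powr r) = t powr r * (\<Sum>i\<in>UNIV. \<bar>x $ i\<bar> powr r)"
    using assms by (simp add: abs_mult powr_mult sum_distrib_left)
  then show ?thesis
    using assms by (simp add: lr_norm_def powr_mult powr_powr)
qed

lemma phi_separable:
  assumes "p > 0"
  shows "phi (p + 1) p x = (\<Sum>i\<in>UNIV. norm (x $ i) powr (p + 1) / (p + 1))"
  using assms by (simp add: phi_def lr_norm_def powr_powr sum_nonneg sum_divide_distrib)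

text \<open>For \<open>r = 2\<close> the maximiser is the power map of the space itself; for \<open>r = p + 1\<close> the
  function \<open>\<phi>\<close> is a sum over the coordinates, so the maximiser is the power map in each of them.\<close>

lemma grad_phi_conj_maximises:
  fixes v x :: "real ^ 'n"
  assumes "p > 0" and r: "r = 2 \<or> r = p + 1"
  shows "inner v x - phi r p x
    \<le> inner v (grad (phi_conj r p) v) - phi r p (grad (phi_conj r p) v)"
proof -
  obtain g :: "real ^ 'n \<Rightarrow> real ^ 'n" where
    max: "\<And>v x. inner v x - phi r p x \<le> inner v (g v) - phi r p (g v)"
    and cont: "\<And>v. isCont g v"
    using r
  proof
    assume "r = 2"
    then have "inner v x - phi r p x \<le> inner v (power_map (1 / p) v) - phi r p (power_map (1 / p) v)"
      for v x :: "real ^ 'n"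
      using power_map_maximises[OF \<open>p > 0\<close>, of v x] by (simp add: phi_def lr_norm_2)
    with that show thesis
      using isCont_power_map \<open>p > 0\<close> by (metis divide_pos_pos zero_less_one)
  next
    assume r: "r = p + 1"
    define g where "g v = (\<chi> i. power_map (1 / p) (v $ i))" for v :: "real ^ 'n"
    have "inner v x - phi r p x \<le> inner v (g v) - phi r p (g v)" for v x :: "real ^ 'n"
      unfolding r phi_separable[OF \<open>p > 0\<close>] inner_vec_def sum_subtractf[symmetric]
      by (rule sum_mono) (simp only: g_def vec_lambda_beta power_map_maximises[OF \<open>p > 0\<close>])
    moreover have "isCont g v" for v
      unfolding g_def continuous_at
      by (intro tendsto_vec_lambda isCont_tendsto_compose[OF isCont_power_map] tendsto_vec_nth
          tendsto_ident_at) (use \<open>p > 0\<close> in auto)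
    ultimately show thesis
      using that by blast
  qed
  have "grad (phi_conj r p) v = g v"
    unfolding phi_conj_def[abs_def] by (rule grad_conjugate_eq_maximiser[OF max cont])
  then show ?thesis
    by (simp add: max)
qed

section \<open>One proximal step\<close>

text \<open>With \<open>d = (w - z) / \<tau>\<close> and \<open>x' = (w - x) / \<tau>\<close>, maximality of \<open>d\<close> for \<open>\<langle>v, \<cdot>\<rangle> - \<phi>\<close> and
  \<open>\<phi> d \<ge> 0\<close> give \<open>\<langle>v, z - x\<rangle> = \<tau> \<langle>v, x' - d\<rangle> \<le> \<tau> \<phi> x'\<close>, and \<open>\<tau> \<phi> x'\<close> is the penalty term
  because \<open>\<phi>\<close> is homogeneous of degree \<open>p + 1\<close>. The \<open>e\<close>-subgradient inequality, which bounds
  \<open>\<psi> z - \<psi> x\<close> by \<open>\<langle>v, z - x\<rangle> + e\<close>, then eliminates \<open>v\<close>.\<close>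

lemma prox_step_bound:
  fixes \<psi> :: "real ^ 'n \<Rightarrow> ereal"
  assumes "p > 0" and r: "r = 2 \<or> r = p + 1" and "\<tau> > 0"
    and sub: "v \<in> eps_subdifferential \<psi> e z"
    and z: "z = w - \<tau> *\<^sub>R grad (phi_conj r p) v"
  shows "\<psi> z \<le> \<psi> x + ereal (\<tau> powr (-p) / (p + 1) * lr_norm r (w - x) powr (p + 1) + e)"
proof (cases "\<psi> x = \<infinity>")
  case False
  have r_pos: "r > 0"
    using r \<open>p > 0\<close> by auto
  define d where "d = grad (phi_conj r p) v"
  define x' where "x' = (1 / \<tau>) *\<^sub>R (w - x)"
  have "inner v x' - phi r p x' \<le> inner v d - phi r p d"
    unfolding d_def by (rule grad_phi_conj_maximises[OF \<open>p > 0\<close> r])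
  moreover have "phi r p d \<ge> 0"
    using \<open>p > 0\<close> by (simp add: phi_def)
  ultimately have "inner v (x' - d) \<le> phi r p x'"
    by (simp add: inner_diff_right)
  then have "\<tau> * inner v (x' - d) \<le> \<tau> * phi r p x'"
    using \<open>\<tau> > 0\<close> by simp
  moreover have "z - x = \<tau> *\<^sub>R (x' - d)"
    using \<open>\<tau> > 0\<close> by (simp add: z d_def x'_def algebra_simps)
  moreover have "\<tau> * phi r p x' = \<tau> powr (-p) / (p + 1) * lr_norm r (w - x) powr (p + 1)"
    using \<open>\<tau> > 0\<close> r_pos
    by (simp add: phi_def x'_def lr_norm_scaleR powr_mult powr_divide powr_add powr_minus_divide)
  ultimately have step: "inner v (z - x) \<le> \<tau> powr (-p) / (p + 1) * lr_norm r (w - x) powr (p + 1)"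
    by simp
  have "x \<in> domain \<psi>"
    using False by (simp add: domain_def)
  then have "\<psi> z + ereal (inner v (x - z)) - ereal e \<le> \<psi> x"
    using sub by (auto simp: eps_subdifferential_def)
  then have "\<psi> z \<le> \<psi> x + ereal (inner v (z - x) + e)"
    by (cases "\<psi> z"; cases "\<psi> x") (auto simp: inner_diff_right)
  also have "\<dots> \<le> \<psi> x + ereal (\<tau> powr (-p) / (p + 1) * lr_norm r (w - x) powr (p + 1) + e)"
    using step by (intro add_left_mono) simp
  finally show ?thesis .
qed simp

section \<open>The rate of decrease\<close>

text \<open>Young's inequality for \<open>x * 1\<close> is Bernoulli's inequality with a real exponent.\<close>

lemma Bernoulli_powr:
  fixes a x :: real
  assumes "a > 1" and "0 \<le> x"
  shows "1 - a * (1 - x) \<le> x powr a"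
proof -
  define b where "b = a / (a - 1)"
  have b: "b > 1" "1 / a + 1 / b = 1"
    using assms by (auto simp: b_def field_simps)
  have "x * 1 \<le> x powr a / a + 1 powr b / b"
    using assms b by (intro Youngs_inequality) auto
  also have "\<dots> = x powr a / a + 1 - 1 / a"
    using b by simp
  finally have "a * x \<le> a * (x powr a / a + 1 - 1 / a)"
    using assms by simp
  also have "\<dots> = x powr a + a - 1"
    using assms by (simp add: algebra_simps)
  finally show ?thesis
    by (simp add: algebra_simps)
qed

lemma power_weight_le:
  assumes "a > 1"
  shows "1 - real k powr a / real (k + 1) powr a \<le> a / real (k + 1)"
proof -
  have "1 - a * (1 - real k / real (k + 1)) \<le> (real k / real (k + 1)) powr a"
    using assms by (intro Bernoulli_powr) auto
  moreover have "1 - real k / real (k + 1) = 1 / real (k + 1)"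
    by (simp add: field_simps)
  ultimately show ?thesis
    by (simp add: powr_divide)
qed

text \<open>Multiplying the recurrence by \<open>(k + 1)\<^sup>p\<^sup>+\<^sup>1\<close> turns \<open>t\<^sub>k \<delta>\<^sub>k\<close> into \<open>k\<^sup>p\<^sup>+\<^sup>1 \<delta>\<^sub>k\<close>, the error
  term into \<open>c\<close>, and the distance term into at most \<open>(p + 1)\<^sup>p B\<close>. Hence \<open>k\<^sup>p\<^sup>+\<^sup>1 \<delta>\<^sub>k\<close> grows at
  most linearly, whatever \<open>\<delta>\<^sub>0\<close> is, as its weight is \<open>0\<close>.\<close>

lemma averaged_recurrence_rate:
  fixes \<delta> :: "nat \<Rightarrow> real"
  assumes "p > 0" and "B \<ge> 0"
    and t: "\<And>k. t k = real k powr (p + 1) / real (k + 1) powr (p + 1)"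
    and rec: "\<And>k. \<delta> (Suc k) \<le> t k * \<delta> k + (1 - t k) powr (p + 1) * (B / (p + 1))
                 + c / real (k + 1) powr (p + 1)"
    and "k \<ge> 1"
  shows "\<delta> k \<le> ((p + 1) powr p * B + c) / real k powr p"
proof -
  define M where "M = (p + 1) powr p * B + c"
  have weighted: "real k powr (p + 1) * \<delta> k \<le> real k * M" for k
  proof (induction k)
    case 0
    then show ?case
      by simp
  next
    case (Suc k)
    define A where "A = real (k + 1) powr (p + 1)"
    have A: "A > 0"
      by (simp add: A_def)
    have "t k \<le> 1"
      using \<open>p > 0\<close> by (simp add: t divide_le_eq_1 powr_mono2)
    then have "(1 - t k) powr (p + 1) \<le> ((p + 1) / real (k + 1)) powr (p + 1)"
      using power_weight_le[of "p + 1" k] \<open>p > 0\<close> by (intro powr_mono2) (auto simp: t)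
    also have "\<dots> = (p + 1) powr (p + 1) / A"
      by (simp add: A_def powr_divide)
    finally have "A * (1 - t k) powr (p + 1) \<le> (p + 1) powr (p + 1)"
      using A by (simp add: field_simps)
    then have "A * (1 - t k) powr (p + 1) * (B / (p + 1)) \<le> (p + 1) powr (p + 1) * (B / (p + 1))"
      using \<open>B \<ge> 0\<close> \<open>p > 0\<close> by (intro mult_right_mono) auto
    also have "\<dots> = (p + 1) powr p * B"
      using \<open>p > 0\<close> by (simp add: powr_add)
    finally have err: "A * ((1 - t k) powr (p + 1) * (B / (p + 1))) \<le> (p + 1) powr p * B"
      by (simp add: mult.assoc)
    have "A * \<delta> (Suc k) \<le> A * (t k * \<delta> k + (1 - t k) powr (p + 1) * (B / (p + 1)) + c / A)"
      using rec[of k] A by (simp add: A_def)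
    also have "\<dots> = A * t k * \<delta> k + A * ((1 - t k) powr (p + 1) * (B / (p + 1))) + c"
      using A by (simp add: algebra_simps)
    also have "A * t k = real k powr (p + 1)"
      using A by (simp add: t A_def)
    finally have "A * \<delta> (Suc k) \<le> real k * M + M"
      using Suc.IH err by (simp add: M_def)
    then show ?case
      by (simp add: A_def algebra_simps)
  qed
  have k: "real k > 0"
    using \<open>k \<ge> 1\<close> by simp
  have "real k * (real k powr p * \<delta> k) \<le> real k * M"
    using weighted[of k] k by (simp add: powr_add mult_ac)
  then have "real k powr p * \<delta> k \<le> M"
    using k by simp
  then show ?thesis
    using k by (simp add: M_def field_simps)
qed

text \<open>The common core of both parts. The points \<open>w\<^sub>k\<close> enter only through their distance to the
  test points \<open>t\<^sub>k y\<^sub>k + (1 - t\<^sub>k) y\<^sup>*\<close>. Finiteness is assumed from \<open>y\<^sub>1\<close> on only: the starting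
  point may lie outside the domain of \<open>\<psi>\<close>.\<close>

lemma prox_sequence_rate:
  fixes \<psi> :: "real ^ 'n \<Rightarrow> ereal" and y w :: "nat \<Rightarrow> real ^ 'n"
  assumes conv: "ereal_convex \<psi>" and "p > 0"
    and t: "\<And>k. t k = real k powr (p + 1) / real (k + 1) powr (p + 1)"
    and star: "\<bar>\<psi> ystar\<bar> \<noteq> \<infinity>"
    and fin: "\<And>k. \<bar>\<psi> (y (Suc k))\<bar> \<noteq> \<infinity>"
    and step: "\<And>k x. \<psi> (y (Suc k)) \<le> \<psi> x +
        ereal (\<tau> powr (-p) / (p + 1) * lr_norm r (w k - x) powr (p + 1)
               + c / real (k + 1) powr (p + 1))"
    and near: "\<And>k. lr_norm r (w k - (t k *\<^sub>R y k + (1 - t k) *\<^sub>R ystar)) \<le> (1 - t k) * R"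
    and "k \<ge> 1"
  shows "\<psi> (y k) - \<psi> ystar
    \<le> ereal ((\<tau> powr (-p) * (p + 1) powr p * R powr (p + 1) + c) / real k powr p)"
proof -
  define \<delta> where "\<delta> k = real_of_ereal (\<psi> (y k)) - real_of_ereal (\<psi> ystar)" for k
  define B where "B = \<tau> powr (-p) * R powr (p + 1)"
  have t01: "0 \<le> t k" "t k \<le> 1" for k
    using \<open>p > 0\<close> by (simp_all add: t divide_le_eq_1 powr_mono2)
  have rec: "\<delta> (Suc k) \<le> t k * \<delta> k + (1 - t k) powr (p + 1) * (B / (p + 1))
                 + c / real (k + 1) powr (p + 1)" for k
  proof -
    define x where "x = t k *\<^sub>R y k + (1 - t k) *\<^sub>R ystar"
    obtain s where s: "\<psi> ystar = ereal s"
      using star by auto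
    obtain z where z: "\<psi> (y (Suc k)) = ereal z"
      using fin by blast
    have "\<psi> x \<le> ereal (t k) * \<psi> (y k) + ereal (1 - t k) * \<psi> ystar"
      using conv t01[of k] unfolding ereal_convex_def x_def by simp
    also have "\<dots> = ereal (t k * real_of_ereal (\<psi> (y k)) + (1 - t k) * s)"
    proof (cases k)
      case 0
      \<comment> \<open>Here \<open>t\<^sub>0 = 0\<close>, so both sides ignore \<open>\<psi> (y\<^sub>0)\<close>, even if it is \<open>\<infinity>\<close>.\<close>
      then show ?thesis
        by (simp add: s t zero_ereal_def[symmetric])
    next
      case (Suc j)
      then obtain u where "\<psi> (y k) = ereal u"
        using fin by blast
      then show ?thesis
        by (simp add: s)
    qed
    finally have x: "\<psi> x \<le> ereal (t k * real_of_ereal (\<psi> (y k)) + (1 - t k) * s)" .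
    have "lr_norm r (w k - x) powr (p + 1) \<le> ((1 - t k) * R) powr (p + 1)"
      using near[of k] \<open>p > 0\<close> by (intro powr_mono2) (auto simp: x_def lr_norm_nonneg)
    then have "\<tau> powr (-p) / (p + 1) * lr_norm r (w k - x) powr (p + 1)
        \<le> \<tau> powr (-p) / (p + 1) * ((1 - t k) * R) powr (p + 1)"
      using \<open>p > 0\<close> by (intro mult_left_mono) auto
    also have "\<dots> = (1 - t k) powr (p + 1) * (B / (p + 1))"
      by (simp add: B_def powr_mult)
    finally have dist: "\<tau> powr (-p) / (p + 1) * lr_norm r (w k - x) powr (p + 1)
        \<le> (1 - t k) powr (p + 1) * (B / (p + 1))" .
    have "ereal z \<le> ereal (t k * real_of_ereal (\<psi> (y k)) + (1 - t k) * s) +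
        ereal ((1 - t k) powr (p + 1) * (B / (p + 1)) + c / real (k + 1) powr (p + 1))"
      unfolding z[symmetric]
      by (rule order_trans[OF step[of k x] add_mono[OF x]]) (use dist in simp)
    then show ?thesis
      by (simp add: \<delta>_def z s algebra_simps)
  qed
  have "\<delta> k \<le> ((p + 1) powr p * B + c) / real k powr p"
    by (rule averaged_recurrence_rate[OF \<open>p > 0\<close> _ t rec \<open>k \<ge> 1\<close>]) (simp add: B_def)
  moreover have "\<psi> (y k) - \<psi> ystar = ereal (\<delta> k)"
  proof -
    obtain j where "k = Suc j"
      using \<open>k \<ge> 1\<close> by (cases k) auto
    then have "\<bar>\<psi> (y k)\<bar> \<noteq> \<infinity>"
      using fin by simp
    then show ?thesis
      using star by (cases "\<psi> (y k)"; cases "\<psi> ystar") (auto simp: \<delta>_def)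
  qed
  ultimately show ?thesis
    by (simp add: B_def mult_ac)
qed

section \<open>The two choices of the averaging parameters\<close>

lemma argmin_proper_finite:
  assumes "proper \<psi>" and "x \<in> argmin_set \<psi>"
  shows "\<bar>\<psi> x\<bar> \<noteq> \<infinity>"
proof -
  obtain z where "\<psi> z < \<infinity>"
    using assms(1) by (auto simp: proper_def domain_def)
  moreover have "\<not> \<psi> z < \<psi> x"
    using assms(2) by (auto simp: argmin_set_def is_arg_min_def)
  ultimately have "\<psi> x < \<infinity>"
    by auto
  moreover have "\<psi> x \<noteq> -\<infinity>"
    using assms(1) by (simp add: proper_def)
  ultimately show ?thesis
    by auto
qed

lemma almost_descent_level:
  fixes f :: "nat \<Rightarrow> ereal"
  assumes "\<And>k. f (Suc k) \<le> f k + ereal (e k)"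
    and "summable e" and "\<And>k. e k \<ge> 0"
  shows "f k \<le> f 0 + ereal (suminf e)"
proof -
  have "f k \<le> f 0 + ereal (\<Sum>i<k. e i)"
  proof (induction k)
    case (Suc k)
    have "f (Suc k) \<le> f k + ereal (e k)"
      by (rule assms)
    also have "\<dots> \<le> f 0 + ereal (\<Sum>i<k. e i) + ereal (e k)"
      by (rule add_right_mono) (rule Suc.IH)
    finally show ?case
      by (simp add: add.assoc)
  qed simp
  also have "\<dots> \<le> f 0 + ereal (suminf e)"
    using assms by (intro add_left_mono) (simp add: sum_le_suminf)
  finally show ?thesis .
qed

theorem theorem3p3:
  fixes \<psi> :: "real ^ 'n \<Rightarrow> ereal"
    and p r \<tau> c \<beta> :: real
    and y0 ystar :: "real ^ 'n"
    and y :: "nat \<Rightarrow> real ^ 'n"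
    and \<epsilon> \<theta> :: "nat \<Rightarrow> real"
  assumes "proper \<psi>" and "lsc \<psi>" and "ereal_convex \<psi>"
    and "argmin_set \<psi> \<noteq> {}"
    and "p \<ge> 1" and "r = 2 \<or> r = p + 1" and "\<tau> > 0"
    and "ystar \<in> argmin_set \<psi>"
    and "c \<ge> 0"
    and "\<forall>k. \<epsilon> k = c / real (k + 1) powr (p + 1)"
    and "inexact_power_ppm_avg r p \<tau> \<psi> \<epsilon> \<theta> y0 y"
    and "\<beta> = (\<Sum>k. \<epsilon> k)"
  shows "((\<forall>k. \<theta> k = real k powr (p + 1) / real (k + 1) powr (p + 1)) \<longrightarrow>
           (\<forall>k\<ge>1. \<psi> (y k) - \<psi> ystar \<le>
              ereal ((\<tau> powr (-p) * (p + 1) powr p * lr_norm r (y0 - ystar) powr (p + 1) + c)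
                     / real k powr p)))
       \<and> ((\<forall>k. \<theta> k = 1) \<and> D_beta r \<psi> ystar y0 \<beta> < \<infinity> \<longrightarrow>
           (\<forall>k\<ge>1. \<psi> (y k) - \<psi> ystar \<le>
              ereal ((\<tau> powr (-p) * (p + 1) powr p
                        * real_of_ereal (D_beta r \<psi> ystar y0 \<beta>) powr (p + 1) + c)
                     / real k powr p)))"
proof -
  have p: "p > 0" and r: "r > 0"
    using assms(5,6) by auto
  define t where "t k = real k powr (p + 1) / real (k + 1) powr (p + 1)" for k
  have t1: "t k \<le> 1" for k
    using p by (simp add: t_def divide_le_eq_1 powr_mono2)
  have y_0: "y 0 = y0"
    using assms(11) by (simp add: inexact_power_ppm_avg_def)
  obtain w v where w: "\<And>k. w k = \<theta> k *\<^sub>R y k + (1 - \<theta> k) *\<^sub>R y0"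
    and v: "\<And>k. v k \<in> eps_subdifferential \<psi> (\<epsilon> k) (y (Suc k))"
    and y: "\<And>k. y (Suc k) = w k - \<tau> *\<^sub>R grad (phi_conj r p) (v k)"
    using assms(11) unfolding inexact_power_ppm_avg_def by blast
  have step': "\<psi> (y (Suc k)) \<le> \<psi> x +
      ereal (\<tau> powr (-p) / (p + 1) * lr_norm r (w k - x) powr (p + 1) + \<epsilon> k)" for k x
    by (rule prox_step_bound[OF p assms(6,7) v y])
  note step = step'[unfolded assms(10)[rule_format]]
  have fin: "\<bar>\<psi> (y (Suc k))\<bar> \<noteq> \<infinity>" for k
    using v[of k] assms(1) by (auto simp: eps_subdifferential_def domain_def proper_def)
  have star: "\<bar>\<psi> ystar\<bar> \<noteq> \<infinity>"
    by (rule argmin_proper_finite[OF assms(1,8)])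
  note rate = prox_sequence_rate[OF assms(3) p t_def star fin step]
  show ?thesis
  proof (intro conjI impI allI)
    fix k :: nat
    assume \<theta>: "\<forall>k. \<theta> k = real k powr (p + 1) / real (k + 1) powr (p + 1)" and k: "1 \<le> k"
    have diff: "w k - (t k *\<^sub>R y k + (1 - t k) *\<^sub>R ystar) = (1 - t k) *\<^sub>R (y0 - ystar)" for k
      using \<theta> by (simp add: w t_def algebra_simps)
    have "lr_norm r (w k - (t k *\<^sub>R y k + (1 - t k) *\<^sub>R ystar)) \<le> (1 - t k) * lr_norm r (y0 - ystar)" for k
      unfolding diff using r t1[of k] by (simp add: lr_norm_scaleR)
    then show "\<psi> (y k) - \<psi> ystar \<le>
        ereal ((\<tau> powr (-p) * (p + 1) powr p * lr_norm r (y0 - ystar) powr (p + 1) + c) / real k powr p)"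
      by (rule rate[OF _ k])
  next
    fix k :: nat
    assume A: "(\<forall>k. \<theta> k = 1) \<and> D_beta r \<psi> ystar y0 \<beta> < \<infinity>" and k: "1 \<le> k"
    define D where "D = real_of_ereal (D_beta r \<psi> ystar y0 \<beta>)"
    have \<epsilon>: "\<epsilon> k \<ge> 0" for k
      using assms(9,10) by simp
    have "summable (\<lambda>k. real k powr (- (p + 1)))"
      using p by (simp add: summable_real_powr_iff)
    then have "summable (\<lambda>k. c * real (Suc k) powr (- (p + 1)))"
      by (intro summable_mult) (subst summable_Suc_iff)
    moreover have "\<epsilon> = (\<lambda>k. c * real (Suc k) powr (- (p + 1)))"
      unfolding powr_minus_divide using assms(10) by auto
    ultimately have "summable \<epsilon>"
      by simp
    \<comment> \<open>Testing the proximal inequality at \<open>x = w\<^sub>k = y\<^sub>k\<close> keeps the iterates in the level set.\<close>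
    moreover have "\<psi> (y (Suc k)) \<le> \<psi> (y k) + ereal (\<epsilon> k)" for k
    proof -
      have "lr_norm r (w k - y k) = 0"
        using A by (simp add: w lr_norm_def)
      then show ?thesis
        using step'[of k "y k"] by simp
    qed
    ultimately have level: "\<psi> (y k) \<le> \<psi> y0 + ereal \<beta>" for k
      using almost_descent_level[of "\<lambda>k. \<psi> (y k)" \<epsilon> k] \<epsilon> by (simp add: assms(12) y_0)
    have sup: "ereal (lr_norm r (ystar - y k)) \<le> D_beta r \<psi> ystar y0 \<beta>" for k
      unfolding D_beta_def using level by (intro SUP_upper) simp
    \<comment> \<open>The level set contains \<open>y\<^sub>0\<close>, so the supremum is not \<open>-\<infinity>\<close>.\<close>
    have D: "D_beta r \<psi> ystar y0 \<beta> = ereal D"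
      using A sup[of 0] by (cases "D_beta r \<psi> ystar y0 \<beta>") (simp_all add: D_def)
    have diff: "w k - (t k *\<^sub>R y k + (1 - t k) *\<^sub>R ystar) = (1 - t k) *\<^sub>R (y k - ystar)" for k
      using A by (simp add: w algebra_simps)
    have "lr_norm r (y k - ystar) \<le> D" for k
      using sup[of k] by (simp add: D lr_norm_minus_commute)
    then have "lr_norm r (w k - (t k *\<^sub>R y k + (1 - t k) *\<^sub>R ystar)) \<le> (1 - t k) * D" for k
      unfolding diff using r t1[of k] by (simp add: lr_norm_scaleR mult_left_mono)
    then show "\<psi> (y k) - \<psi> ystar \<le>
        ereal ((\<tau> powr (-p) * (p + 1) powr p
                  * real_of_ereal (D_beta r \<psi> ystar y0 \<beta>) powr (p + 1) + c) / real k powr p)"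
      unfolding D_def[symmetric] by (rule rate[OF _ k])
  qed
qed

end
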